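(* Suppose that $\big((\underline{\alpha}^{d}_{j})_{j\in\mathcal{D}^{+}},(\underline{\alpha}^{s}_{i})_{i\in\mathcal{S}^{-}}\big)$ are market-activating bids for the coordinated market described in the context, with associated optimal allocations $(s,d,f,c)$ and clearing prices $\pi$. Then these bids provide exactly the funds required to achieve revenue adequacy with zero profit, that is, $$\sum_{j\in\mathcal{D}^{+}}\underline{\alpha}^{d}_{j}d_{j}-\sum_{i\in\mathcal{S}^{-}}\underline{\alpha}^{s}_{i}s_{i}=\sum_{i\in\mathcal{S}^{+}}\alpha^{s}_{i}s_{i}-\sum_{j\in\mathcal{D}^{-}}\alpha^{d}_{j}d_{j}+\sum_{l\in\mathcal{L}}\alpha^{f}_{l}f_{l}+\sum_{t\in\mathcal{T}}\alpha^{c}_{t}c_{t}.$$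
   Context: **Market data.** Let $\mathcal{N}$ (geographical nodes), $\mathcal{P}$ (products), $\mathcal{S}$ (suppliers), $\mathcal{D}$ (consumers), $\mathcal{L}$ (transport providers) and $\mathcal{T}$ (technology providers) be finite sets. - Each supplier $i\in\mathcal{S}$ has a node $n(i)\in\mathcal{N}$, a product $p(i)\in\mathcal{P}$, a bid $\alpha^{s}_{i}\in\mathbb{R}$ and a capacity $\overline{s}_{i}\ge 0$. - Each consumer $j\in\mathcal{D}$ has a node $n(j)$, a product $p(j)$, a bid $\alpha^{d}_{j}\in\mathbb{R}$ and a capacity $\overline{d}_{j}\ge 0$. - Each transport provider $l\in\mathcal{L}$ has a source node $n_{s}(l)$, a receiving node $n_{r}(l)$, a product $p(l)$, a bid $\alpha^{f}_{l}\ge 0$ and a capacity $\overline{f}_{l}\ge 0$. - Each technology $t\in\mathcal{T}$ has a node $n(t)$, a set of input products $\mathcal{P}^{con}_{t}\subseteq\mathcal{P}$, a set of output products $\mathcal{P}^{gen}_{t}\subseteq\mathcal{P}$, yield coefficients $\gamma_{t,p}\ge 0$ for its inputs and outputs, a reference input product $\bar p(t)\in\mathcal{P}^{con}_{t}$ with $\gamma_{t,\bar p(t)}=1$, a bid $\alpha^{c}_{t}\ge 0$ and a capacity $\overline{c}_{t}\ge 0$. The variable $c_{t}$ is the consumption of the reference product. The technology consumes $\gamma_{t,p}c_{t}$ of each $p\in\mathcal{P}^{con}_{t}$ and generates $\gamma_{t,p}c_{t}$ of each $p\in\mathcal{P}^{gen}_{t}$. For each $(n,p)$ let $\mathcal{S}_{n,p}=\{i: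 n(i)=n,p(i)=p\}$, $\mathcal{D}_{n,p}=\{j: n(j)=n,p(j)=p\}$, $\mathcal{L}^{in}_{n,p}=\{l: n_{r}(l)=n,p(l)=p\}$, $\mathcal{L}^{out}_{n,p}=\{l: n_{s}(l)=n,p(l)=p\}$, $\mathcal{T}^{con}_{n,p}=\{t: n(t)=n,p\in\mathcal{P}^{con}_{t}\}$ and $\mathcal{T}^{gen}_{n,p}=\{t: n(t)=n,p\in\mathcal{P}^{gen}_{t}\}$. **Market clearing problem.** Maximize $$\sum_{j\in\mathcal{D}}\alpha^{d}_{j}d_{j}-\sum_{i\in\mathcal{S}}\alpha^{s}_{i}s_{i}-\sum_{l\in\mathcal{L}}\alpha^{f}_{l}f_{l}-\sum_{t\in\mathcal{T}}\alpha^{c}_{t}c_{t}$$ over $0\le s_{i}\le\overline{s}_{i}$, $0\le d_{j}\le\overline{d}_{j}$, $0\le f_{l}\le\overline{f}_{l}$, $0\le c_{t}\le\overline{c}_{t}$, subject to the balance (clearing) constraint, for every $(n,p)\in\mathcal{N}\times\mathcal{P}$, $$\sum_{i\in\mathcal{S}_{n,p}}s_{i}+\sum_{l\in\mathcal{L}^{in}_{n,p}}f_{l}+\sum_{t\in\mathcal{T}^{gen}_{n,p}}\gamma_{t,p}c_{t}=\sum_{j\in\mathcal{D}_{n,p}}d_{j}+\sum_{l\in\mathcal{L}^{out}_{n,p}}f_{l}+\sum_{t\in\mathcal{T}^{con}_{n,p}}\gamma_{t,p}c_{t}.$$ **Prices.** Let $\pi^{bal}_{n,p}\in\mathbb{R}$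 be optimal dual variables of the balance constraints. The sign convention is that the Lagrangian of the equivalent minimization problem contains the term $\pi^{bal}_{n,p}\cdot(\text{right-hand side}-\text{left-hand side})$. The clearing prices $\pi$ are $$\pi_{i}=\pi^{bal}_{n(i),p(i)},\qquad \pi_{j}=\pi^{bal}_{n(j),p(j)},\qquad \pi_{l}=\pi^{bal}_{n_{r}(l),p(l)}-\pi^{bal}_{n_{s}(l),p(l)},$$ $$\pi_{t}=\sum_{p\in\mathcal{P}^{gen}_{t}}\gamma_{t,p}\pi^{bal}_{n(t),p}-\sum_{p\in\mathcal{P}^{con}_{t}}\gamma_{t,p}\pi^{bal}_{n(t),p}.$$ **Profits.** $\phi^{s}_{i}=(\pi_{i}-\alpha^{s}_{i})s_{i}$, $\phi^{d}_{j}=(\alpha^{d}_{j}-\pi_{j})d_{j}$, $\phi^{f}_{l}=(\pi_{l}-\alpha^{f}_{l})f_{l}$, $\phi^{c}_{t}=(\pi_{t}-\alpha^{c}_{t})c_{t}$. A stakeholder is cleared if its allocation is nonzero. The sets of cleared stakeholders are $\mathcal{S}^{*},\mathcal{D}^{*},\mathcal{L}^{*},\mathcal{T}^{*}$. **Revenue adequacy** means that the payments collected are exactly sufficient to make all payments owed: $\sum_{j}\pi_{j}d_{j}=\sum_{i}\pi_{i}s_{i}+\sum_{l}\pi_{l}f_{l}+\sum_{t}\pi_{t}c_{t}$. **Sign partition.** $\mathcal{S}^{-}=\{i:\alpha^{s}_{i}<0\}$, $\mathcal{S}^{+}=\{i:\alpha^{s}_{i}\ge 0\}$, $\mathcal{D}^{-}=\{j:\alpha^{d}_{j}<0\}$,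 $\mathcal{D}^{+}=\{j:\alpha^{d}_{j}\ge 0\}$. **Market-activating bids.** Treat the bids of the stakeholders in $\mathcal{S}^{+},\mathcal{D}^{-},\mathcal{L},\mathcal{T}$ as given constants. Bids $\underline{\alpha}^{d}_{j}$ ($j\in\mathcal{D}^{+}$) and $\underline{\alpha}^{s}_{i}$ ($i\in\mathcal{S}^{-}$) are market-activating if the following holds when they are used as the bids $\alpha^{d}_{j}$, $\alpha^{s}_{i}$ of those stakeholders: the clearing problem has an optimal allocation $(s,d,f,c)$ with cleared transactions $(\mathcal{S}^{*},\mathcal{D}^{*},\mathcal{L}^{*},\mathcal{T}^{*})$, and associated clearing prices $\pi$, for which all stakeholder profits $\phi^{s}_{i},\phi^{d}_{j},\phi^{f}_{l},\phi^{c}_{t}$ are zero. *)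

theory Defs
  imports Complex_Main "HOL-Library.Extended_Real"
begin

text \<open>All index sets are explicit carriers, hence possibly empty; values of the fields outside
  their carriers are irrelevant.\<close>

record ('n, 'p, 's, 'd, 'l, 't) market =
  nodes :: "'n set"
  products :: "'p set"
  suppliers :: "'s set"
  consumers :: "'d set"
  transports :: "'l set"
  techs :: "'t set"
  node_s :: "'s \<Rightarrow> 'n"
  prod_s :: "'s \<Rightarrow> 'p"
  bid_s :: "'s \<Rightarrow> real"
  cap_s :: "'s \<Rightarrow> real"
  node_d :: "'d \<Rightarrow> 'n"
  prod_d :: "'d \<Rightarrow> 'p"
  bid_d :: "'d \<Rightarrow> real"
  cap_d :: "'d \<Rightarrow> real"
  src_f :: "'l \<Rightarrow> 'n"
  rcv_f :: "'l \<Rightarrow> 'n"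
  prod_f :: "'l \<Rightarrow> 'p"
  bid_f :: "'l \<Rightarrow> real"
  cap_f :: "'l \<Rightarrow> real"
  node_c :: "'t \<Rightarrow> 'n"
  inputs :: "'t \<Rightarrow> 'p set"
  outputs :: "'t \<Rightarrow> 'p set"
  gam :: "'t \<Rightarrow> 'p \<Rightarrow> real"
  ref_prod :: "'t \<Rightarrow> 'p"
  bid_c :: "'t \<Rightarrow> real"
  cap_c :: "'t \<Rightarrow> real"

record ('s, 'd, 'l, 't) allocation =
  al_s :: "'s \<Rightarrow> real"
  al_d :: "'d \<Rightarrow> real"
  al_f :: "'l \<Rightarrow> real"
  al_c :: "'t \<Rightarrow> real"

locale coordinated_market =
  fixes M :: "('n, 'p, 's, 'd, 'l, 't) market"
  assumes finite_carriers:
      "finite (nodes M)" "finite (products M)" "finite (suppliers M)"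
      "finite (consumers M)" "finite (transports M)" "finite (techs M)"
    and supplier: "i \<in> suppliers M \<Longrightarrow>
      node_s M i \<in> nodes M \<and> prod_s M i \<in> products M \<and> 0 \<le> cap_s M i"
    and consumer: "j \<in> consumers M \<Longrightarrow>
      node_d M j \<in> nodes M \<and> prod_d M j \<in> products M \<and> 0 \<le> cap_d M j"
    and transport: "l \<in> transports M \<Longrightarrow>
      src_f M l \<in> nodes M \<and> rcv_f M l \<in> nodes M \<and> prod_f M l \<in> products M \<and>
      0 \<le> bid_f M l \<and> 0 \<le> cap_f M l"
    and tech: "t \<in> techs M \<Longrightarrow>
      node_c M t \<in> nodes M \<and> inputs M t \<subseteq> products M \<and> outputs M t \<subseteq> products M \<and>
      (\<forall>p \<in> inputs M t \<union> outputs M t. 0 \<le> gam M t p) \<and>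
      ref_prod M t \<in> inputs M t \<and> gam M t (ref_prod M t) = 1 \<and>
      0 \<le> bid_c M t \<and> 0 \<le> cap_c M t"

definition S_at :: "('n, 'p, 's, 'd, 'l, 't) market \<Rightarrow> 'n \<Rightarrow> 'p \<Rightarrow> 's set" where
  "S_at M n p = {i \<in> suppliers M. node_s M i = n \<and> prod_s M i = p}"

definition D_at :: "('n, 'p, 's, 'd, 'l, 't) market \<Rightarrow> 'n \<Rightarrow> 'p \<Rightarrow> 'd set" where
  "D_at M n p = {j \<in> consumers M. node_d M j = n \<and> prod_d M j = p}"

definition L_in :: "('n, 'p, 's, 'd, 'l, 't) market \<Rightarrow> 'n \<Rightarrow> 'p \<Rightarrow> 'l set" where
  "L_in M n p = {l \<in> transports M. rcv_f M l = n \<and> prod_f M l = p}"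

definition L_out :: "('n, 'p, 's, 'd, 'l, 't) market \<Rightarrow> 'n \<Rightarrow> 'p \<Rightarrow> 'l set" where
  "L_out M n p = {l \<in> transports M. src_f M l = n \<and> prod_f M l = p}"

definition T_con :: "('n, 'p, 's, 'd, 'l, 't) market \<Rightarrow> 'n \<Rightarrow> 'p \<Rightarrow> 't set" where
  "T_con M n p = {t \<in> techs M. node_c M t = n \<and> p \<in> inputs M t}"

definition T_gen :: "('n, 'p, 's, 'd, 'l, 't) market \<Rightarrow> 'n \<Rightarrow> 'p \<Rightarrow> 't set" where
  "T_gen M n p = {t \<in> techs M. node_c M t = n \<and> p \<in> outputs M t}"

definition inflow ::
    "('n, 'p, 's, 'd, 'l, 't) market \<Rightarrow> ('s, 'd, 'l, 't) allocation \<Rightarrow> 'n \<Rightarrow> 'p \<Rightarrow> real" where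
  "inflow M x n p =
     (\<Sum>i\<in>S_at M n p. al_s x i) + (\<Sum>l\<in>L_in M n p. al_f x l)
     + (\<Sum>t\<in>T_gen M n p. gam M t p * al_c x t)"

definition outflow ::
    "('n, 'p, 's, 'd, 'l, 't) market \<Rightarrow> ('s, 'd, 'l, 't) allocation \<Rightarrow> 'n \<Rightarrow> 'p \<Rightarrow> real" where
  "outflow M x n p =
     (\<Sum>j\<in>D_at M n p. al_d x j) + (\<Sum>l\<in>L_out M n p. al_f x l)
     + (\<Sum>t\<in>T_con M n p. gam M t p * al_c x t)"

definition within_caps ::
    "('n, 'p, 's, 'd, 'l, 't) market \<Rightarrow> ('s, 'd, 'l, 't) allocation set" where
  "within_caps M = {x.
     (\<forall>i\<in>suppliers M. 0 \<le> al_s x i \<and> al_s x i \<le> cap_s M i) \<and>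
     (\<forall>j\<in>consumers M. 0 \<le> al_d x j \<and> al_d x j \<le> cap_d M j) \<and>
     (\<forall>l\<in>transports M. 0 \<le> al_f x l \<and> al_f x l \<le> cap_f M l) \<and>
     (\<forall>t\<in>techs M. 0 \<le> al_c x t \<and> al_c x t \<le> cap_c M t)}"

definition feasible ::
    "('n, 'p, 's, 'd, 'l, 't) market \<Rightarrow> ('s, 'd, 'l, 't) allocation set" where
  "feasible M = {x \<in> within_caps M. \<forall>n\<in>nodes M. \<forall>p\<in>products M. inflow M x n p = outflow M x n p}"

definition welfare ::
    "('n, 'p, 's, 'd, 'l, 't) market \<Rightarrow> ('s, 'd, 'l, 't) allocation \<Rightarrow> real" where
  "welfare M x =
     (\<Sum>j\<in>consumers M. bid_d M j * al_d x j) - (\<Sum>i\<in>suppliers M. bid_s M i * al_s x i)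
     - (\<Sum>l\<in>transports M. bid_f M l * al_f x l) - (\<Sum>t\<in>techs M. bid_c M t * al_c x t)"

definition optimal_allocation ::
    "('n, 'p, 's, 'd, 'l, 't) market \<Rightarrow> ('s, 'd, 'l, 't) allocation \<Rightarrow> bool" where
  "optimal_allocation M x \<longleftrightarrow> x \<in> feasible M \<and> (\<forall>y\<in>feasible M. welfare M y \<le> welfare M x)"

text \<open>The Lagrangian belongs to the minimization of the negated welfare. Only the balance
  constraints are dualized; the capacity bounds stay as the domain of the inner minimization.\<close>

definition lagrangian ::
    "('n, 'p, 's, 'd, 'l, 't) market \<Rightarrow> ('s, 'd, 'l, 't) allocation \<Rightarrow> ('n \<Rightarrow> 'p \<Rightarrow> real) \<Rightarrow> real" where
  "lagrangian M x \<pi> = - welfare M x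
     + (\<Sum>n\<in>nodes M. \<Sum>p\<in>products M. \<pi> n p * (outflow M x n p - inflow M x n p))"

definition dual_function ::
    "('n, 'p, 's, 'd, 'l, 't) market \<Rightarrow> ('n \<Rightarrow> 'p \<Rightarrow> real) \<Rightarrow> ereal" where
  "dual_function M \<pi> = (INF x\<in>within_caps M. ereal (lagrangian M x \<pi>))"

definition optimal_dual ::
    "('n, 'p, 's, 'd, 'l, 't) market \<Rightarrow> ('n \<Rightarrow> 'p \<Rightarrow> real) \<Rightarrow> bool" where
  "optimal_dual M \<pi> \<longleftrightarrow> (\<forall>\<rho>. dual_function M \<rho> \<le> dual_function M \<pi>)"

definition price_s ::
    "('n, 'p, 's, 'd, 'l, 't) market \<Rightarrow> ('n \<Rightarrow> 'p \<Rightarrow> real) \<Rightarrow> 's \<Rightarrow> real" where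
  "price_s M \<pi> i = \<pi> (node_s M i) (prod_s M i)"

definition price_d ::
    "('n, 'p, 's, 'd, 'l, 't) market \<Rightarrow> ('n \<Rightarrow> 'p \<Rightarrow> real) \<Rightarrow> 'd \<Rightarrow> real" where
  "price_d M \<pi> j = \<pi> (node_d M j) (prod_d M j)"

definition price_f ::
    "('n, 'p, 's, 'd, 'l, 't) market \<Rightarrow> ('n \<Rightarrow> 'p \<Rightarrow> real) \<Rightarrow> 'l \<Rightarrow> real" where
  "price_f M \<pi> l = \<pi> (rcv_f M l) (prod_f M l) - \<pi> (src_f M l) (prod_f M l)"

definition price_c ::
    "('n, 'p, 's, 'd, 'l, 't) market \<Rightarrow> ('n \<Rightarrow> 'p \<Rightarrow> real) \<Rightarrow> 't \<Rightarrow> real" where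
  "price_c M \<pi> t =
     (\<Sum>p\<in>outputs M t. gam M t p * \<pi> (node_c M t) p)
     - (\<Sum>p\<in>inputs M t. gam M t p * \<pi> (node_c M t) p)"

definition profit_s :: "('n, 'p, 's, 'd, 'l, 't) market \<Rightarrow> ('n \<Rightarrow> 'p \<Rightarrow> real) \<Rightarrow>
    ('s, 'd, 'l, 't) allocation \<Rightarrow> 's \<Rightarrow> real" where
  "profit_s M \<pi> x i = (price_s M \<pi> i - bid_s M i) * al_s x i"

definition profit_d :: "('n, 'p, 's, 'd, 'l, 't) market \<Rightarrow> ('n \<Rightarrow> 'p \<Rightarrow> real) \<Rightarrow>
    ('s, 'd, 'l, 't) allocation \<Rightarrow> 'd \<Rightarrow> real" where
  "profit_d M \<pi> x j = (bid_d M j - price_d M \<pi> j) * al_d x j"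

definition profit_f :: "('n, 'p, 's, 'd, 'l, 't) market \<Rightarrow> ('n \<Rightarrow> 'p \<Rightarrow> real) \<Rightarrow>
    ('s, 'd, 'l, 't) allocation \<Rightarrow> 'l \<Rightarrow> real" where
  "profit_f M \<pi> x l = (price_f M \<pi> l - bid_f M l) * al_f x l"

definition profit_c :: "('n, 'p, 's, 'd, 'l, 't) market \<Rightarrow> ('n \<Rightarrow> 'p \<Rightarrow> real) \<Rightarrow>
    ('s, 'd, 'l, 't) allocation \<Rightarrow> 't \<Rightarrow> real" where
  "profit_c M \<pi> x t = (price_c M \<pi> t - bid_c M t) * al_c x t"

definition S_neg :: "('n, 'p, 's, 'd, 'l, 't) market \<Rightarrow> 's set" where
  "S_neg M = {i \<in> suppliers M. bid_s M i < 0}"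

definition S_pos :: "('n, 'p, 's, 'd, 'l, 't) market \<Rightarrow> 's set" where
  "S_pos M = {i \<in> suppliers M. bid_s M i \<ge> 0}"

definition D_neg :: "('n, 'p, 's, 'd, 'l, 't) market \<Rightarrow> 'd set" where
  "D_neg M = {j \<in> consumers M. bid_d M j < 0}"

definition D_pos :: "('n, 'p, 's, 'd, 'l, 't) market \<Rightarrow> 'd set" where
  "D_pos M = {j \<in> consumers M. bid_d M j \<ge> 0}"

text \<open>The sign partition is taken with respect to the bids of \<open>M\<close>; the signs of the substituted
  bids \<open>ad\<close> and \<open>as\<close> are not constrained.\<close>

definition with_bids :: "('n, 'p, 's, 'd, 'l, 't) market \<Rightarrow> ('d \<Rightarrow> real) \<Rightarrow> ('s \<Rightarrow> real) \<Rightarrow>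
    ('n, 'p, 's, 'd, 'l, 't) market" where
  "with_bids M ad as = M\<lparr>
     bid_d := (\<lambda>j. if j \<in> D_pos M then ad j else bid_d M j),
     bid_s := (\<lambda>i. if i \<in> S_neg M then as i else bid_s M i)\<rparr>"

definition zero_profit_clearing :: "('n, 'p, 's, 'd, 'l, 't) market \<Rightarrow>
    ('s, 'd, 'l, 't) allocation \<Rightarrow> ('n \<Rightarrow> 'p \<Rightarrow> real) \<Rightarrow> bool" where
  "zero_profit_clearing M x \<pi> \<longleftrightarrow>
     optimal_allocation M x \<and> optimal_dual M \<pi> \<and>
     (\<forall>i\<in>suppliers M. profit_s M \<pi> x i = 0) \<and>
     (\<forall>j\<in>consumers M. profit_d M \<pi> x j = 0) \<and>
     (\<forall>l\<in>transports M. profit_f M \<pi> x l = 0) \<and>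
     (\<forall>t\<in>techs M. profit_c M \<pi> x t = 0)"

definition market_activating ::
    "('n, 'p, 's, 'd, 'l, 't) market \<Rightarrow> ('d \<Rightarrow> real) \<Rightarrow> ('s \<Rightarrow> real) \<Rightarrow> bool" where
  "market_activating M ad as \<longleftrightarrow> (\<exists>x \<pi>. zero_profit_clearing (with_bids M ad as) x \<pi>)"

end

theory Submission
  imports Defs
begin

text \<open>Revenue adequacy is an accounting identity: valuing the balance constraint of every pair
  \<open>(n, p)\<close> at the price \<open>\<pi> n p\<close> and adding up, each stakeholder contributes its allocation
  times exactly the price defined for it (consumers with the opposite sign), because a supplier or
  consumer appears in one balance, a transport provider in two with opposite signs, and a technology
  in one for each of its inputs and outputs. This regrouping is \<open>sum_located_values\<close>, and the resulting identity is
  \<open>value_of_imbalance\<close>. As feasible allocations have no imbalance, payments collected equal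
  payments owed (\<open>revenue_adequacy\<close>).

  At a zero-profit clearing the bid can replace the price in every payment, so the same identity
  says that the welfare is zero (\<open>zero_profit_imp_zero_welfare\<close>). For the market with
  substituted bids, splitting the welfare by the signs of the original bids gives the claim.\<close>

text \<open>A value located at \<open>a t\<close> and spread over the products in \<open>Q t\<close> is counted in the cells
  \<open>(a t, p)\<close> with \<open>p \<in> Q t\<close> and in no other, so it makes no difference whether values are added
  cell by cell or owner by owner.\<close>

lemma sum_located_values:
  fixes w :: "'t \<Rightarrow> 'p \<Rightarrow> 'a::comm_semiring_0"
  assumes fin: "finite N" "finite P" "finite T"
    and loc: "\<And>t. t \<in> T \<Longrightarrow> a t \<in> N" "\<And>t. t \<in> T \<Longrightarrow> Q t \<subseteq> P"
  shows "(\<Sum>n\<in>N. \<Sum>p\<in>P. \<pi> n p * (\<Sum>t | t \<in> T \<and> a t = n \<and> p \<in> Q t. w t p))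
       = (\<Sum>t\<in>T. \<Sum>p\<in>Q t. \<pi> (a t) p * w t p)"
proof -
  have "(\<Sum>n\<in>N. \<Sum>p\<in>P. \<pi> n p * (\<Sum>t | t \<in> T \<and> a t = n \<and> p \<in> Q t. w t p))
      = (\<Sum>n\<in>N. \<Sum>p\<in>P. \<Sum>t\<in>T. if a t = n \<and> p \<in> Q t then \<pi> n p * w t p else 0)"
    using fin(3) by (auto simp: sum_distrib_left sum.inter_filter intro!: sum.cong)
  also have "\<dots> = (\<Sum>n\<in>N. \<Sum>t\<in>T. \<Sum>p\<in>P. if a t = n \<and> p \<in> Q t then \<pi> n p * w t p else 0)"
    by (intro sum.cong refl sum.swap)
  also have "\<dots> = (\<Sum>t\<in>T. \<Sum>n\<in>N. \<Sum>p\<in>P. if a t = n \<and> p \<in> Q t then \<pi> n p * w t p else 0)"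
    by (rule sum.swap)
  also have "\<dots> = (\<Sum>t\<in>T. \<Sum>p\<in>Q t. \<pi> (a t) p * w t p)"
  proof (rule sum.cong[OF refl])
    fix t assume t: "t \<in> T"
    have "(\<Sum>n\<in>N. \<Sum>p\<in>P. if a t = n \<and> p \<in> Q t then \<pi> n p * w t p else 0)
        = (\<Sum>n\<in>N. if a t = n then \<Sum>p\<in>P. if p \<in> Q t then \<pi> n p * w t p else 0 else 0)"
      by (intro sum.cong) auto
    also have "\<dots> = (\<Sum>p\<in>P. if p \<in> Q t then \<pi> (a t) p * w t p else 0)"
      using fin(1) loc(1)[OF t] by simp
    also have "\<dots> = (\<Sum>p\<in>P \<inter> Q t. \<pi> (a t) p * w t p)"
      using fin(2) by (simp add: sum.inter_restrict)
    also have "P \<inter> Q t = Q t"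
      using loc(2)[OF t] by blast
    finally show "(\<Sum>n\<in>N. \<Sum>p\<in>P. if a t = n \<and> p \<in> Q t then \<pi> n p * w t p else 0)
        = (\<Sum>p\<in>Q t. \<pi> (a t) p * w t p)" .
  qed
  finally show ?thesis .
qed

lemma sum_located_values_single:
  fixes w :: "'t \<Rightarrow> 'a::comm_semiring_0"
  assumes "finite N" "finite P" "finite T"
    and "\<And>t. t \<in> T \<Longrightarrow> a t \<in> N" "\<And>t. t \<in> T \<Longrightarrow> b t \<in> P"
  shows "(\<Sum>n\<in>N. \<Sum>p\<in>P. \<pi> n p * (\<Sum>t | t \<in> T \<and> a t = n \<and> b t = p. w t))
       = (\<Sum>t\<in>T. \<pi> (a t) (b t) * w t)"
  using sum_located_values[where Q = "\<lambda>t. {b t}" and w = "\<lambda>t p. w t" and a = a and \<pi> = \<pi>, OF assms(1-4)]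
    assms(5) by (simp add: eq_commute)

context coordinated_market
begin

lemma value_of_inflow:
  "(\<Sum>n\<in>nodes M. \<Sum>p\<in>products M. \<pi> n p * inflow M x n p)
   = (\<Sum>i\<in>suppliers M. price_s M \<pi> i * al_s x i)
     + (\<Sum>l\<in>transports M. \<pi> (rcv_f M l) (prod_f M l) * al_f x l)
     + (\<Sum>t\<in>techs M. (\<Sum>p\<in>outputs M t. gam M t p * \<pi> (node_c M t) p) * al_c x t)"
proof -
  have "(\<Sum>n\<in>nodes M. \<Sum>p\<in>products M. \<pi> n p * (\<Sum>i\<in>S_at M n p. al_s x i))
      = (\<Sum>i\<in>suppliers M. price_s M \<pi> i * al_s x i)"
    unfolding S_at_def price_s_def
    by (rule sum_located_values_single) (use finite_carriers supplier in auto)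
  moreover have "(\<Sum>n\<in>nodes M. \<Sum>p\<in>products M. \<pi> n p * (\<Sum>l\<in>L_in M n p. al_f x l))
      = (\<Sum>l\<in>transports M. \<pi> (rcv_f M l) (prod_f M l) * al_f x l)"
    unfolding L_in_def
    by (rule sum_located_values_single) (use finite_carriers transport in auto)
  moreover have "(\<Sum>n\<in>nodes M. \<Sum>p\<in>products M. \<pi> n p * (\<Sum>t\<in>T_gen M n p. gam M t p * al_c x t))
      = (\<Sum>t\<in>techs M. \<Sum>p\<in>outputs M t. \<pi> (node_c M t) p * (gam M t p * al_c x t))"
    unfolding T_gen_def
    by (rule sum_located_values) (use finite_carriers tech in auto)
  ultimately show ?thesis
    by (simp add: inflow_def distrib_left sum.distrib sum_distrib_left mult_ac)
qed

lemma value_of_outflow: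
  "(\<Sum>n\<in>nodes M. \<Sum>p\<in>products M. \<pi> n p * outflow M x n p)
   = (\<Sum>j\<in>consumers M. price_d M \<pi> j * al_d x j)
     + (\<Sum>l\<in>transports M. \<pi> (src_f M l) (prod_f M l) * al_f x l)
     + (\<Sum>t\<in>techs M. (\<Sum>p\<in>inputs M t. gam M t p * \<pi> (node_c M t) p) * al_c x t)"
proof -
  have "(\<Sum>n\<in>nodes M. \<Sum>p\<in>products M. \<pi> n p * (\<Sum>j\<in>D_at M n p. al_d x j))
      = (\<Sum>j\<in>consumers M. price_d M \<pi> j * al_d x j)"
    unfolding D_at_def price_d_def
    by (rule sum_located_values_single) (use finite_carriers consumer in auto)
  moreover have "(\<Sum>n\<in>nodes M. \<Sum>p\<in>products M. \<pi> n p * (\<Sum>l\<in>L_out M n p. al_f x l))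
      = (\<Sum>l\<in>transports M. \<pi> (src_f M l) (prod_f M l) * al_f x l)"
    unfolding L_out_def
    by (rule sum_located_values_single) (use finite_carriers transport in auto)
  moreover have "(\<Sum>n\<in>nodes M. \<Sum>p\<in>products M. \<pi> n p * (\<Sum>t\<in>T_con M n p. gam M t p * al_c x t))
      = (\<Sum>t\<in>techs M. \<Sum>p\<in>inputs M t. \<pi> (node_c M t) p * (gam M t p * al_c x t))"
    unfolding T_con_def
    by (rule sum_located_values) (use finite_carriers tech in auto)
  ultimately show ?thesis
    by (simp add: outflow_def distrib_left sum.distrib sum_distrib_left mult_ac)
qed

text \<open>The prices of transport and technology are differences of nodal prices because these
  stakeholders move or convert products: they occur on both sides of the balances.\<close>

lemma value_of_imbalance:
  "(\<Sum>n\<in>nodes M. \<Sum>p\<in>products M. \<pi> n p * (inflow M x n p - outflow M x n p))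
   = (\<Sum>i\<in>suppliers M. price_s M \<pi> i * al_s x i) + (\<Sum>l\<in>transports M. price_f M \<pi> l * al_f x l)
     + (\<Sum>t\<in>techs M. price_c M \<pi> t * al_c x t) - (\<Sum>j\<in>consumers M. price_d M \<pi> j * al_d x j)"
  by (simp add: right_diff_distrib left_diff_distrib sum_subtractf value_of_inflow value_of_outflow
      price_f_def price_c_def)

lemma revenue_adequacy:
  assumes "x \<in> feasible M"
  shows "(\<Sum>j\<in>consumers M. price_d M \<pi> j * al_d x j)
       = (\<Sum>i\<in>suppliers M. price_s M \<pi> i * al_s x i) + (\<Sum>l\<in>transports M. price_f M \<pi> l * al_f x l)
         + (\<Sum>t\<in>techs M. price_c M \<pi> t * al_c x t)"
proof -
  have "(\<Sum>n\<in>nodes M. \<Sum>p\<in>products M. \<pi> n p * (inflow M x n p - outflow M x n p)) = 0"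
    using assms by (simp add: feasible_def)
  then show ?thesis
    by (simp add: value_of_imbalance)
qed

text \<open>The welfare differs from the total profit only by the payments collected minus the payments
  owed, which is zero by revenue adequacy.\<close>

lemma zero_profit_imp_zero_welfare:
  assumes "zero_profit_clearing M x \<pi>"
  shows "welfare M x = 0"
proof -
  have "x \<in> feasible M"
    using assms by (simp add: zero_profit_clearing_def optimal_allocation_def)
  moreover have "(\<Sum>i\<in>suppliers M. price_s M \<pi> i * al_s x i) = (\<Sum>i\<in>suppliers M. bid_s M i * al_s x i)"
    using assms by (intro sum.cong) (auto simp: zero_profit_clearing_def profit_s_def)
  moreover have "(\<Sum>j\<in>consumers M. price_d M \<pi> j * al_d x j) = (\<Sum>j\<in>consumers M. bid_d M j * al_d x j)"
    using assms by (intro sum.cong) (auto simp: zero_profit_clearing_def profit_d_def)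
  moreover have "(\<Sum>l\<in>transports M. price_f M \<pi> l * al_f x l) = (\<Sum>l\<in>transports M. bid_f M l * al_f x l)"
    using assms by (intro sum.cong) (auto simp: zero_profit_clearing_def profit_f_def)
  moreover have "(\<Sum>t\<in>techs M. price_c M \<pi> t * al_c x t) = (\<Sum>t\<in>techs M. bid_c M t * al_c x t)"
    using assms by (intro sum.cong) (auto simp: zero_profit_clearing_def profit_c_def)
  ultimately show ?thesis
    using revenue_adequacy[of x \<pi>] by (simp add: welfare_def)
qed

lemma coordinated_market_with_bids: "coordinated_market (with_bids M ad as)"
  using finite_carriers supplier consumer transport tech
  unfolding with_bids_def by unfold_locales auto

lemma welfare_with_bids:
  "welfare (with_bids M ad as) x
   = (\<Sum>j\<in>D_pos M. ad j * al_d x j) + (\<Sum>j\<in>D_neg M. bid_d M j * al_d x j)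
     - ((\<Sum>i\<in>S_neg M. as i * al_s x i) + (\<Sum>i\<in>S_pos M. bid_s M i * al_s x i))
     - (\<Sum>l\<in>transports M. bid_f M l * al_f x l) - (\<Sum>t\<in>techs M. bid_c M t * al_c x t)"
proof -
  have D: "consumers M = D_pos M \<union> D_neg M" "D_pos M \<inter> D_neg M = {}"
    and S: "suppliers M = S_neg M \<union> S_pos M" "S_neg M \<inter> S_pos M = {}"
    by (auto simp: D_pos_def D_neg_def S_pos_def S_neg_def)
  have fin: "finite (D_pos M)" "finite (D_neg M)" "finite (S_neg M)" "finite (S_pos M)"
    using finite_carriers by (auto simp: D_pos_def D_neg_def S_pos_def S_neg_def)
  have "(\<Sum>j\<in>consumers M. (if j \<in> D_pos M then ad j else bid_d M j) * al_d x j)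
      = (\<Sum>j\<in>D_pos M. ad j * al_d x j) + (\<Sum>j\<in>D_neg M. bid_d M j * al_d x j)"
    unfolding D(1) sum.union_disjoint[OF fin(1,2) D(2)]
    using D(2) by (intro arg_cong2[where f = "(+)"] sum.cong) auto
  moreover have "(\<Sum>i\<in>suppliers M. (if i \<in> S_neg M then as i else bid_s M i) * al_s x i)
      = (\<Sum>i\<in>S_neg M. as i * al_s x i) + (\<Sum>i\<in>S_pos M. bid_s M i * al_s x i)"
    unfolding S(1) sum.union_disjoint[OF fin(3,4) S(2)]
    using S(2) by (intro arg_cong2[where f = "(+)"] sum.cong) auto
  ultimately show ?thesis
    by (simp add: welfare_def with_bids_def)
qed

end

theorem theorem6:
  fixes M :: "('n, 'p, 's, 'd, 'l, 't) market"
    and ad :: "'d \<Rightarrow> real" and as :: "'s \<Rightarrow> real"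
    and x :: "('s, 'd, 'l, 't) allocation"
    and \<pi> :: "'n \<Rightarrow> 'p \<Rightarrow> real"
  assumes "coordinated_market M"
    and "market_activating M ad as"
    and "zero_profit_clearing (with_bids M ad as) x \<pi>"
  shows "(\<Sum>j\<in>D_pos M. ad j * al_d x j) - (\<Sum>i\<in>S_neg M. as i * al_s x i)
       = (\<Sum>i\<in>S_pos M. bid_s M i * al_s x i) - (\<Sum>j\<in>D_neg M. bid_d M j * al_d x j)
         + (\<Sum>l\<in>transports M. bid_f M l * al_f x l) + (\<Sum>t\<in>techs M. bid_c M t * al_c x t)"
proof -
  have "welfare (with_bids M ad as) x = 0"
    using assms(1,3) coordinated_market.coordinated_market_with_bids
      coordinated_market.zero_profit_imp_zero_welfare by blast
  then show ?thesis
    using coordinated_market.welfare_with_bids[OF assms(1)] by simp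
qed

end
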